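(* For every $r>0$ and $y\ge\frac1r\ln(1+\theta)$, the equation $$(1+\theta)+\eta y-\eta R-e^{rR}=0$$ has a unique solution $R=R_c(r,y)\in[0,y]$. Put $$\widetilde R(r,y)=\begin{cases}y,&0\le y<\frac1r\ln(1+\theta),\\ R_c(r,y),&y\ge\frac1r\ln(1+\theta).\end{cases}$$ The maximum adjustment coefficient $\rho_J=\sup_R\rho(R)>0$ is the unique solution $r>0$ of $$c-\lambda\mu=r\left\{\lambda\int_0^\infty\frac{e^{r\widetilde R(r,y)}-1}{r}\,S_Y(y)\,dy+\frac{\beta^2}{2}\right\},$$ and the corresponding optimal retention function (attaining the supremum) is $\widetilde R_J(y)=\widetilde R(\rho_J,y)$, that is, $$\widetilde R_J(y)=\begin{cases}y,&0\le y<\frac{1}{\rho_J}\ln(1+\theta),\\ R_c(\rho_J,y),&y\ge\frac{1}{\rho_J}\ln(1+\theta).\end{cases}$$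
   Context: Data: $\lambda>0$, $\beta>0$, $c$, $\theta\ge0$, $\eta\ge0$ are constants. $Y$ is a positive random variable with cumulative distribution function $F_Y$ such that $F_Y(0)=0$ and $0<F_Y(y)<1$ for $y>0$; $S_Y=1-F_Y$; the moment generating function of $Y$ is finite in a neighborhood of $0$; $\mu=\mathbb{E}Y$ and $\sigma^2=\mathbb{E}(Y^2)$ (the second moment). It is assumed that $c>\lambda\mu$ and that $\kappa:=(1+\theta)\lambda\mu+\frac{\eta}{2}\lambda\sigma^2-c>0$. A retention function is a Borel function $R:[0,\infty)\to[0,\infty)$ with $0\le R(y)\le y$; $\mathbb E R=\mathbb E R(Y)$, $\mathbb E(YR)=\mathbb E(YR(Y))$, $\mathbb E(R^2)=\mathbb E(R(Y)^2)$, and $M_R(r)=\mathbb E(e^{rR(Y)})$. Adjustment coefficient: for a retention function $R$, $\rho(R)$ denotes the positive solution $r$, when it exists (it is then unique), of $$\Big[-\kappa+\lambda\Big((1+\theta)\mathbb E R+\eta\,\mathbb E(YR)-\frac{\eta}{2}\mathbb E(R^2)\Big)\Big]r-\frac12\beta^2r^2-\lambda\big(M_R(r)-1\big)=0 .$$ The supremum $\sup_R\rho(R)$ is over all retention functions for which $\rho(R)$ exists. ($\rho(R)$ is the adjustment coefficient of the surplus process $dX_t=[-\kappa+\lambda((1+\theta)\mathbb E R+\eta\mathbb E(YR)-\frac\eta2\mathbb E(R^2))]dt-R\,dN_t+\beta\,dW_t$, with $N$ a Poisson process of rate $\lambda$ and $W$ an independent Brownian motion.) *)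

theory Defs
  imports "HOL-Probability.Probability"
begin

text \<open>
  Retention functions are total on the reals, but only their values on [0, infinity) are
  constrained; as the claim size is almost surely positive, the other values play no role.
  Every Borel function on [0, infinity) extends to such a function.
\<close>
definition retention :: "(real \<Rightarrow> real) \<Rightarrow> bool" where
  "retention R \<longleftrightarrow> R \<in> borel_measurable borel \<and> (\<forall>y\<ge>0. 0 \<le> R y \<and> R y \<le> y)"

definition survival :: "'a measure \<Rightarrow> ('a \<Rightarrow> real) \<Rightarrow> real \<Rightarrow> real" where
  "survival M Y y = 1 - cdf (distr M borel Y) y"

definition kappa :: "'a measure \<Rightarrow> ('a \<Rightarrow> real) \<Rightarrow> real \<Rightarrow> real \<Rightarrow> real \<Rightarrow> real \<Rightarrow> real" where
  "kappa M Y lam c \<theta> \<eta> =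
     (1 + \<theta>) * lam * (\<integral>\<omega>. Y \<omega> \<partial>M) + \<eta> / 2 * lam * (\<integral>\<omega>. (Y \<omega>)\<^sup>2 \<partial>M) - c"

definition adj_fun ::
  "'a measure \<Rightarrow> ('a \<Rightarrow> real) \<Rightarrow> real \<Rightarrow> real \<Rightarrow> real \<Rightarrow> real \<Rightarrow> real \<Rightarrow>
    (real \<Rightarrow> real) \<Rightarrow> real \<Rightarrow> real" where
  "adj_fun M Y lam \<beta> c \<theta> \<eta> R r =
     (- kappa M Y lam c \<theta> \<eta>
        + lam * ((1 + \<theta>) * (\<integral>\<omega>. R (Y \<omega>) \<partial>M)
                 + \<eta> * (\<integral>\<omega>. Y \<omega> * R (Y \<omega>) \<partial>M)
                 - \<eta> / 2 * (\<integral>\<omega>. (R (Y \<omega>))\<^sup>2 \<partial>M))) * r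
     - 1 / 2 * \<beta>\<^sup>2 * r\<^sup>2
     - lam * ((\<integral>\<omega>. exp (r * R (Y \<omega>)) \<partial>M) - 1)"

text \<open>
  The integrability condition says that the moment generating function of the retained claim is
  finite at r; without it the Bochner integral would be 0 by convention and could produce
  spurious roots.
\<close>
definition is_adj_coeff ::
  "'a measure \<Rightarrow> ('a \<Rightarrow> real) \<Rightarrow> real \<Rightarrow> real \<Rightarrow> real \<Rightarrow> real \<Rightarrow> real \<Rightarrow>
    (real \<Rightarrow> real) \<Rightarrow> real \<Rightarrow> bool" where
  "is_adj_coeff M Y lam \<beta> c \<theta> \<eta> R r \<longleftrightarrow>
     r > 0 \<and> integrable M (\<lambda>\<omega>. exp (r * R (Y \<omega>))) \<and> adj_fun M Y lam \<beta> c \<theta> \<eta> R r = 0"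

definition adj_coeff ::
  "'a measure \<Rightarrow> ('a \<Rightarrow> real) \<Rightarrow> real \<Rightarrow> real \<Rightarrow> real \<Rightarrow> real \<Rightarrow> real \<Rightarrow>
    (real \<Rightarrow> real) \<Rightarrow> real" where
  "adj_coeff M Y lam \<beta> c \<theta> \<eta> R = (THE r. is_adj_coeff M Y lam \<beta> c \<theta> \<eta> R r)"

definition adj_retentions ::
  "'a measure \<Rightarrow> ('a \<Rightarrow> real) \<Rightarrow> real \<Rightarrow> real \<Rightarrow> real \<Rightarrow> real \<Rightarrow> real \<Rightarrow>
    (real \<Rightarrow> real) set" where
  "adj_retentions M Y lam \<beta> c \<theta> \<eta> =
     {R. retention R \<and> (\<exists>r. is_adj_coeff M Y lam \<beta> c \<theta> \<eta> R r)}"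

definition Rc_eq :: "real \<Rightarrow> real \<Rightarrow> real \<Rightarrow> real \<Rightarrow> real \<Rightarrow> bool" where
  "Rc_eq \<theta> \<eta> r y R \<longleftrightarrow> (1 + \<theta>) + \<eta> * y - \<eta> * R - exp (r * R) = 0"

definition Rc :: "real \<Rightarrow> real \<Rightarrow> real \<Rightarrow> real \<Rightarrow> real" where
  "Rc \<theta> \<eta> r y = (THE R. R \<in> {0..y} \<and> Rc_eq \<theta> \<eta> r y R)"

text \<open>For negative y, where the paper leaves it undefined, this is extended by the identity.\<close>
definition Rtilde :: "real \<Rightarrow> real \<Rightarrow> real \<Rightarrow> real \<Rightarrow> real" where
  "Rtilde \<theta> \<eta> r y = (if y < 1 / r * ln (1 + \<theta>) then y else Rc \<theta> \<eta> r y)"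

definition opt_integrand ::
  "'a measure \<Rightarrow> ('a \<Rightarrow> real) \<Rightarrow> real \<Rightarrow> real \<Rightarrow> real \<Rightarrow> real \<Rightarrow> real" where
  "opt_integrand M Y \<theta> \<eta> r y = (exp (r * Rtilde \<theta> \<eta> r y) - 1) / r * survival M Y y"

definition opt_eq ::
  "'a measure \<Rightarrow> ('a \<Rightarrow> real) \<Rightarrow> real \<Rightarrow> real \<Rightarrow> real \<Rightarrow> real \<Rightarrow> real \<Rightarrow> real \<Rightarrow> bool" where
  "opt_eq M Y lam \<beta> c \<theta> \<eta> r \<longleftrightarrow>
     c - lam * (\<integral>\<omega>. Y \<omega> \<partial>M)
       = r * (lam * (LBINT y:{0..}. opt_integrand M Y \<theta> \<eta> r y) + \<beta>\<^sup>2 / 2)"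

end

theory Submission imports Defs begin

text \<open>
  For fixed \<open>r\<close>, the left-hand side of the equation for the adjustment coefficient is, up to terms
  independent of the retention function, \<open>lam\<close> times the expectation of \<open>gain r Y (R(Y))\<close>, and \<open>gain r y\<close> is
  concave with maximiser \<open>Rtilde r y\<close> on \<open>[0, y]\<close>. The derivative of the maximal gain with respect
  to \<open>y\<close> is \<open>r * (1 + \<theta> + \<eta> y - exp (r * Rtilde r y))\<close>, so by the tail formula for expectations
  the maximum over all retention functions is \<open>r * slope r\<close>, where \<open>slope r\<close> is the difference of
  the two sides of the equation claimed for the maximal adjustment coefficient. As \<open>r * Rtilde r y\<close>
  increases with \<open>r\<close> while \<open>Rtilde r y\<close> decreases, \<open>slope\<close> is strictly decreasing and Lipschitz,
  so it has exactly one positive root \<open>s\<close>. Any adjustment coefficient \<open>r\<close>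
  satisfies \<open>slope r \<ge> 0\<close>, hence \<open>r \<le> s\<close>, and \<open>Rtilde s\<close> attains \<open>s\<close>.
\<close>

section \<open>The pointwise optimal retention\<close>

text \<open>The left-hand side is strictly decreasing in \<open>R\<close>. It is nonnegative at
  \<open>0\<close>, and nonpositive at \<open>y\<close> because \<open>y\<close> beyond the
  threshold means \<open>1 + \<theta> \<le> exp (r * y)\<close>. The intermediate value theorem does
  the rest.\<close>

lemma Rc_ex1:
  fixes r y \<theta> \<eta> :: real
  assumes "r > 0" "\<theta> \<ge> 0" "\<eta> \<ge> 0" "y \<ge> 1 / r * ln (1 + \<theta>)"
  shows "\<exists>!R. R \<in> {0..y} \<and> Rc_eq \<theta> \<eta> r y R"
proof (rule ex_ex1I)
  let ?f = "\<lambda>R. (1 + \<theta>) + \<eta> * y - \<eta> * R - exp (r * R)"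
  have y0: "y \<ge> 0"
    using assms by (smt (verit) divide_nonneg_pos ln_ge_zero mult_nonneg_nonneg)
  have "ln (1 + \<theta>) \<le> r * y"
    using assms by (simp add: field_simps)
  then have "1 + \<theta> \<le> exp (r * y)"
    using assms by (metis add_nonneg_pos add.commute exp_le_cancel_iff exp_ln zero_less_one)
  then have "?f y \<le> 0" by simp
  moreover have "0 \<le> ?f 0" using assms y0 by simp
  moreover have "continuous_on {0..y} ?f" by (intro continuous_intros)
  ultimately show "\<exists>R. R \<in> {0..y} \<and> Rc_eq \<theta> \<eta> r y R"
    using IVT2'[of ?f y 0 0] y0 by (auto simp: Rc_eq_def)
next
  fix R R' assume *: "R \<in> {0..y} \<and> Rc_eq \<theta> \<eta> r y R" "R' \<in> {0..y} \<and> Rc_eq \<theta> \<eta> r y R'"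
  have False if "Rc_eq \<theta> \<eta> r y a" "Rc_eq \<theta> \<eta> r y b" "a < b" for a b
  proof -
    have "exp (r * a) < exp (r * b)" using that assms by simp
    moreover have "\<eta> * a \<le> \<eta> * b" using that assms by (simp add: mult_left_mono)
    ultimately show False using that unfolding Rc_eq_def by linarith
  qed
  with * show "R = R'" by (metis linorder_neqE)
qed

text \<open>These are the first-order conditions for maximising a concave function under the
  constraint \<open>x \<le> y\<close>: either the constraint binds or the point is stationary. Later
  arguments mostly rely on them instead of the definite description in \<open>Rc\<close>.\<close>

lemma Rtilde_char:
  fixes r y \<theta> \<eta> :: real
  assumes r: "r > 0" "\<theta> \<ge> 0" "\<eta> \<ge> 0"
  defines "x \<equiv> Rtilde \<theta> \<eta> r y"
  shows "x \<le> y" "exp (r * x) + \<eta> * x \<le> 1 + \<theta> + \<eta> * y"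
    "x = y \<or> exp (r * x) + \<eta> * x = 1 + \<theta> + \<eta> * y"
    "y \<ge> 0 \<Longrightarrow> x \<ge> 0"
    "y \<ge> 1 / r * ln (1 + \<theta>) \<Longrightarrow> exp (r * x) + \<eta> * x = 1 + \<theta> + \<eta> * y"
proof -
  have *: "x = y \<and> exp (r * x) < 1 + \<theta>" if "y < 1 / r * ln (1 + \<theta>)"
  proof -
    have "r * y < ln (1 + \<theta>)" using that r by (simp add: field_simps)
    then have "exp (r * y) < 1 + \<theta>" using r by (metis add_nonneg_pos add.commute exp_less_mono exp_ln zero_less_one)
    then show ?thesis using that by (simp add: x_def Rtilde_def)
  qed
  have **: "x \<in> {0..y} \<and> exp (r * x) + \<eta> * x = 1 + \<theta> + \<eta> * y" if "y \<ge> 1 / r * ln (1 + \<theta>)"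
    using theI'[OF Rc_ex1[OF r that]] that by (auto simp: x_def Rtilde_def Rc_def Rc_eq_def)
  show "x \<le> y" "exp (r * x) + \<eta> * x \<le> 1 + \<theta> + \<eta> * y"
    "x = y \<or> exp (r * x) + \<eta> * x = 1 + \<theta> + \<eta> * y" "y \<ge> 0 \<Longrightarrow> x \<ge> 0"
    "y \<ge> 1 / r * ln (1 + \<theta>) \<Longrightarrow> exp (r * x) + \<eta> * x = 1 + \<theta> + \<eta> * y"
    using * ** by (force simp: not_less)+
qed

lemma exp_Rtilde_le:
  fixes r y \<theta> \<eta> :: real
  assumes "r > 0" "\<theta> \<ge> 0" "\<eta> \<ge> 0" "y \<ge> 0"
  shows "exp (r * Rtilde \<theta> \<eta> r y) \<le> 1 + \<theta> + \<eta> * y"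
  using Rtilde_char(2,4)[OF assms(1-3), of y] assms by (smt (verit) mult_nonneg_nonneg)

lemma exp_plus_linear_less:
  fixes a b r \<eta> :: real
  assumes "r > 0" "\<eta> \<ge> 0" "a < b"
  shows "exp (r * a) + \<eta> * a < exp (r * b) + \<eta> * b"
  using assms by (intro add_less_le_mono) (auto intro: mult_left_mono)

text \<open>If either bound failed, the smaller retained amount would lie strictly below its claim
  and hence be stationary, contradicting the strict growth of
  \<open>exp (r * x) + \<eta> * x\<close>. Monotonicity yields measurability; the bound on
  increments yields the continuity used at the kink. Negative claims are included because the
  derivative at \<open>0\<close> will be two-sided.\<close>

lemma Rtilde_increment:
  fixes r y \<theta> \<eta> :: real
  assumes r: "r > 0" "\<theta> \<ge> 0" "\<eta> \<ge> 0" and "y \<le> y'"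
  shows "Rtilde \<theta> \<eta> r y \<le> Rtilde \<theta> \<eta> r y'"
    "Rtilde \<theta> \<eta> r y' - Rtilde \<theta> \<eta> r y \<le> y' - y"
proof -
  let ?x = "Rtilde \<theta> \<eta> r y" and ?x' = "Rtilde \<theta> \<eta> r y'"
  note c = Rtilde_char[OF r, of y] and c' = Rtilde_char[OF r, of y']
  have m: "\<eta> * y \<le> \<eta> * y'" using assms by (simp add: mult_left_mono)
  show "?x \<le> ?x'"
  proof (rule ccontr)
    assume "\<not> ?x \<le> ?x'"
    then show False
      using exp_plus_linear_less[of r \<eta> ?x' ?x] c(1-3) c'(1-3) m assms by linarith
  qed
  show "?x' - ?x \<le> y' - y"
  proof (rule ccontr)
    assume n: "\<not> ?thesis"
    then have "exp (r * (?x + (y' - y))) + \<eta> * (?x + (y' - y)) < exp (r * ?x') + \<eta> * ?x'"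
      using r by (intro exp_plus_linear_less) auto
    moreover have "exp (r * ?x) \<le> exp (r * (?x + (y' - y)))"
      using assms by simp
    moreover have "\<eta> * (?x + (y' - y)) = \<eta> * ?x + \<eta> * y' - \<eta> * y"
      by (simp add: algebra_simps)
    ultimately show False
      using n c(3) c'(1,2) by linarith
  qed
qed

lemma Rtilde_mono:
  "r > 0 \<Longrightarrow> \<theta> \<ge> 0 \<Longrightarrow> \<eta> \<ge> 0 \<Longrightarrow> mono (Rtilde \<theta> \<eta> r)"
  by (intro monoI Rtilde_increment(1))

lemma Rtilde_lipschitz:
  fixes r y \<theta> \<eta> :: real
  assumes r: "r > 0" "\<theta> \<ge> 0" "\<eta> \<ge> 0"
  shows "\<bar>Rtilde \<theta> \<eta> r z - Rtilde \<theta> \<eta> r y\<bar> \<le> \<bar>z - y\<bar>"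
  using Rtilde_increment[OF r, of y z] Rtilde_increment[OF r, of z y] by linarith

lemma Rtilde_retention:
  "r > 0 \<Longrightarrow> \<theta> \<ge> 0 \<Longrightarrow> \<eta> \<ge> 0 \<Longrightarrow> retention (Rtilde \<theta> \<eta> r)"
  using Rtilde_char(1,4) borel_measurable_mono[OF Rtilde_mono]
  by (auto simp: retention_def)

text \<open>A larger \<open>r\<close> makes retention costlier, so the optimal amount
  \<open>x\<close> falls. At a stationary point
  \<open>exp (r * x) = 1 + \<theta> + \<eta> * (y - x)\<close>, so a smaller \<open>x\<close> goes
  with a larger exponent. If the amount at \<open>r'\<close> is all of \<open>y\<close>, the
  exponents compare directly.\<close>

lemma Rtilde_param_mono:
  fixes r r' y \<theta> \<eta> :: real
  assumes r: "0 < r" "r \<le> r'" "\<theta> \<ge> 0" "\<eta> \<ge> 0" "y \<ge> 0"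
  shows "Rtilde \<theta> \<eta> r' y \<le> Rtilde \<theta> \<eta> r y"
    "r * Rtilde \<theta> \<eta> r y \<le> r' * Rtilde \<theta> \<eta> r' y"
proof -
  let ?x = "Rtilde \<theta> \<eta> r y" and ?x' = "Rtilde \<theta> \<eta> r' y"
  have r': "r' > 0" using r by simp
  note c = Rtilde_char[OF r(1,3,4), of y] and c' = Rtilde_char[OF r' r(3,4), of y]
  have x0: "?x \<ge> 0" "?x' \<ge> 0" using c(4) c'(4) r by auto
  show "?x' \<le> ?x"
  proof (rule ccontr)
    assume n: "\<not> ?thesis"
    have "exp (r * ?x) + \<eta> * ?x < exp (r * ?x') + \<eta> * ?x'"
      using n r by (intro exp_plus_linear_less) auto
    moreover have "exp (r * ?x') \<le> exp (r' * ?x')"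
      using r x0 by (simp add: mult_right_mono)
    ultimately show False using n c(1-3) c'(1-3) by linarith
  qed
  then have "\<eta> * ?x' \<le> \<eta> * ?x" using r by (simp add: mult_left_mono)
  show "r * ?x \<le> r' * ?x'"
  proof (rule ccontr)
    assume n: "\<not> ?thesis"
    then have "exp (r' * ?x') < exp (r * ?x)" by simp
    moreover have "?x' \<noteq> y"
    proof
      assume "?x' = y"
      moreover have "r * ?x \<le> r * y" using c(1) r by simp
      moreover have "r * y \<le> r' * y" using r by (simp add: mult_right_mono)
      ultimately show False using n by simp
    qed
    ultimately show False using c(1-3) c'(1-3) \<open>\<eta> * ?x' \<le> \<eta> * ?x\<close> by linarith
  qed
qed

text \<open>The exponents differ by at most \<open>(r' - r) * y\<close>, and \<open>exp\<close> has
  slope at most \<open>1 + \<theta> + \<eta> * y\<close> up to the larger one. The Lipschitz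
  constant is thus polynomial in \<open>y\<close>. The case \<open>r = 0\<close> is included, the
  exponent being \<open>0\<close> there, so that \<open>excess\<close> can be treated on
  \<open>{0..}\<close>.\<close>

lemma exp_Rtilde_diff_le:
  fixes r r' y \<theta> \<eta> :: real
  assumes r: "0 \<le> r" "r \<le> r'" "\<theta> \<ge> 0" "\<eta> \<ge> 0" "y \<ge> 0"
  shows "exp (r * Rtilde \<theta> \<eta> r y) \<le> exp (r' * Rtilde \<theta> \<eta> r' y)"
    "exp (r' * Rtilde \<theta> \<eta> r' y) - exp (r * Rtilde \<theta> \<eta> r y)
      \<le> (r' - r) * (y * (1 + \<theta> + \<eta> * y))"
proof -
  let ?u = "r * Rtilde \<theta> \<eta> r y" and ?u' = "r' * Rtilde \<theta> \<eta> r' y"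
  have *: "?u \<le> ?u' \<and> ?u' - ?u \<le> (r' - r) * y \<and> exp ?u' \<le> 1 + \<theta> + \<eta> * y"
  proof (cases "r' = 0")
    case True then show ?thesis using r by simp
  next
    case False
    then have r': "r' > 0" using r by simp
    note c' = Rtilde_char[OF r' r(3,4), of y]
    have "?u \<le> ?u'"
      using Rtilde_param_mono(2)[of r r' \<theta> \<eta> y] r r' c' by (cases "r = 0") auto
    moreover have "?u' - ?u \<le> (r' - r) * Rtilde \<theta> \<eta> r' y"
    proof (cases "r = 0")
      case False
      then have "r * Rtilde \<theta> \<eta> r' y \<le> ?u"
        using Rtilde_param_mono(1)[of r r' \<theta> \<eta> y] r by simp
      then show ?thesis by (simp add: algebra_simps)
    qed simp
    moreover have "(r' - r) * Rtilde \<theta> \<eta> r' y \<le> (r' - r) * y"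
      using c'(1) r by (simp add: mult_left_mono)
    ultimately show ?thesis using exp_Rtilde_le[OF r' r(3-5)] by simp
  qed
  then show "exp ?u \<le> exp ?u'" by simp
  \<comment> \<open>Convexity: \<open>exp\<close> lies above its tangent at
    \<open>?u'\<close>.\<close>
  have "exp ?u' * (1 + (?u - ?u')) \<le> exp ?u' * exp (?u - ?u')"
    by (intro mult_left_mono exp_ge_add_one_self) auto
  also have "\<dots> = exp ?u" by (simp flip: exp_add)
  finally have "exp ?u' - exp ?u \<le> exp ?u' * (?u' - ?u)" by (simp add: algebra_simps)
  also have "\<dots> \<le> (1 + \<theta> + \<eta> * y) * ((r' - r) * y)"
    using * r by (intro mult_mono) auto
  finally show "exp ?u' - exp ?u \<le> (r' - r) * (y * (1 + \<theta> + \<eta> * y))"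
    by (simp add: algebra_simps)
qed

section \<open>Maximisation of the gain and the envelope theorem\<close>

text \<open>The integrand, as a function of the claim \<open>y\<close> and the retained amount \<open>x\<close>, of the part of the
  equation for the adjustment coefficient that depends on the retention function, divided by
  \<open>lam\<close>.\<close>
definition gain :: "real \<Rightarrow> real \<Rightarrow> real \<Rightarrow> real \<Rightarrow> real \<Rightarrow> real" where
  "gain \<theta> \<eta> r y x = r * ((1 + \<theta>) * x + \<eta> * (y * x) - \<eta> / 2 * x\<^sup>2) - (exp (r * x) - 1)"

text \<open>By concavity the difference of gains is at most the derivative at \<open>x\<close> times
  \<open>z - x\<close>. Either that derivative vanishes, or it is nonnegative and
  \<open>z \<le> y = x\<close>.\<close>

lemma gain_le_gain_Rtilde:
  fixes r y z \<theta> \<eta> :: real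
  assumes r: "r > 0" "\<theta> \<ge> 0" "\<eta> \<ge> 0" and z: "z \<le> y"
  shows "gain \<theta> \<eta> r y z \<le> gain \<theta> \<eta> r y (Rtilde \<theta> \<eta> r y)"
proof -
  define x where "x = Rtilde \<theta> \<eta> r y"
  note c = Rtilde_char[OF r, of y, folded x_def]
  have "exp (r * x) * (1 + r * (z - x)) \<le> exp (r * x) * exp (r * (z - x))"
    by (intro mult_left_mono exp_ge_add_one_self) auto
  also have "\<dots> = exp (r * z)" by (simp add: algebra_simps flip: exp_add)
  finally have "gain \<theta> \<eta> r y z - gain \<theta> \<eta> r y x
     \<le> r * ((z - x) * (1 + \<theta> + \<eta> * y - (exp (r * x) + \<eta> * x))) - r * \<eta> / 2 * (z - x)\<^sup>2"
    unfolding gain_def by (simp add: power2_eq_square field_simps)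
  also have "\<dots> \<le> 0"
  proof -
    have "(z - x) * (1 + \<theta> + \<eta> * y - (exp (r * x) + \<eta> * x)) \<le> 0"
      using c(2,3) z by (auto intro: mult_nonpos_nonneg)
    then have "r * ((z - x) * (1 + \<theta> + \<eta> * y - (exp (r * x) + \<eta> * x))) \<le> 0"
      using r by (simp add: mult_nonneg_nonpos)
    moreover have "0 \<le> r * \<eta> / 2 * (z - x)\<^sup>2" using r by simp
    ultimately show ?thesis by linarith
  qed
  finally show ?thesis by (simp add: x_def)
qed

lemma isCont_if_nonexpansive:
  fixes f :: "real \<Rightarrow> real"
  assumes "\<And>z. \<bar>f z - f y\<bar> \<le> \<bar>z - y\<bar>"
  shows "isCont f y"
  unfolding isCont_def
proof (rule LIM_zero_cancel, rule tendsto_rabs_zero_cancel)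
  show "(\<lambda>x. \<bar>f x - f y\<bar>) \<midarrow>y\<rightarrow> 0"
    by (rule tendsto_sandwich[of "\<lambda>_. 0" _ _ "\<lambda>z. \<bar>z - y\<bar>"])
      (use assms in \<open>auto intro!: tendsto_eq_intros\<close>)
qed

text \<open>A chain rule for \<open>f\<close> that may have a kink at \<open>y\<close>:
  Caratheodory's factor \<open>g\<close> of \<open>F\<close> tends to \<open>0\<close> along
  \<open>f\<close>, while the difference quotient of \<open>f\<close> stays within
  \<open>[-1, 1]\<close>.\<close>

lemma has_field_derivative_zero_compose_lipschitz:
  fixes F f :: "real \<Rightarrow> real"
  assumes F: "(F has_field_derivative 0) (at (f y))"
    and f: "\<And>z. \<bar>f z - f y\<bar> \<le> \<bar>z - y\<bar>"
  shows "((\<lambda>z. F (f z)) has_field_derivative 0) (at y)"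
proof -
  obtain g where g: "\<forall>z. F z - F (f y) = g z * (z - f y)" "isCont g (f y)" "g (f y) = 0"
    using F unfolding CARAT_DERIV by auto
  have "f \<midarrow>y\<rightarrow> f y"
    using isCont_if_nonexpansive[of f y] f by (simp add: isCont_def)
  then have lim: "(\<lambda>z. \<bar>g (f z)\<bar>) \<midarrow>y\<rightarrow> 0"
    using isCont_tendsto_compose[OF g(2)] g(3) tendsto_rabs_zero by fastforce
  have "(\<lambda>z. (F (f z) - F (f y)) / (z - y)) \<midarrow>y\<rightarrow> 0"
  proof (rule tendsto_rabs_zero_cancel, rule tendsto_sandwich[OF _ _ tendsto_const lim])
    show "\<forall>\<^sub>F z in at y. \<bar>(F (f z) - F (f y)) / (z - y)\<bar> \<le> \<bar>g (f z)\<bar>"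
    proof (intro eventuallyI)
      fix z show "\<bar>(F (f z) - F (f y)) / (z - y)\<bar> \<le> \<bar>g (f z)\<bar>"
        using g(1) f[of z]
        by (cases "z = y") (auto simp: abs_mult divide_simps intro: mult_left_mono)
    qed
  qed auto
  then show ?thesis by (simp add: has_field_derivative_iff)
qed

text \<open>The envelope theorem: beyond the kink of the retention function, its variation contributes
  nothing to first order because it is a stationary point of the gain.\<close>
lemma DERIV_gain_Rtilde:
  fixes r y \<theta> \<eta> :: real
  assumes r: "r > 0" "\<theta> \<ge> 0" "\<eta> \<ge> 0"
  shows "((\<lambda>y. gain \<theta> \<eta> r y (Rtilde \<theta> \<eta> r y)) has_field_derivative
    r * (1 + \<theta> + \<eta> * y - exp (r * Rtilde \<theta> \<eta> r y))) (at y)"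
proof (cases "y < 1 / r * ln (1 + \<theta>)")
  case True
  have "((\<lambda>y. gain \<theta> \<eta> r y y) has_field_derivative r * (1 + \<theta> + \<eta> * y - exp (r * y))) (at y)"
    unfolding gain_def by (auto intro!: derivative_eq_intros simp: algebra_simps)
  moreover have "\<forall>\<^sub>F z in nhds y. gain \<theta> \<eta> r z (Rtilde \<theta> \<eta> r z) = gain \<theta> \<eta> r z z"
    using eventually_nhds_in_open[of "{..<1 / r * ln (1 + \<theta>)}" y] True
    by (auto elim!: eventually_mono simp: Rtilde_def)
  ultimately show ?thesis
    using True DERIV_cong_ev[OF refl _ refl] by (fastforce simp: Rtilde_def)
next
  case False
  \<comment> \<open>The kink itself falls into this case. As the claim enters \<open>gain\<close>
    only through \<open>r * \<eta> * (y * x)\<close>, \<open>gain\<close> at \<open>z\<close> splits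
    into \<open>gain\<close> with the claim frozen at \<open>y\<close>, stationary at
    \<open>R y\<close>, and the remainder \<open>r * \<eta> * ((z - y) * R z)\<close>.\<close>
  define R where "R = Rtilde \<theta> \<eta> r"
  have c: "exp (r * R y) + \<eta> * R y = 1 + \<theta> + \<eta> * y"
    using Rtilde_char(5)[OF r, of y] False by (simp add: R_def)
  have lip: "\<bar>R z - R y\<bar> \<le> \<bar>z - y\<bar>" for z
    using Rtilde_lipschitz[OF r] by (simp add: R_def)
  have "(gain \<theta> \<eta> r y has_field_derivative r * (1 + \<theta> + \<eta> * y - \<eta> * R y - exp (r * R y))) (at (R y))"
    unfolding gain_def[abs_def] by (auto intro!: derivative_eq_intros simp: algebra_simps)
  also have "1 + \<theta> + \<eta> * y - \<eta> * R y - exp (r * R y) = 0" using c by simp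
  finally have 1: "((\<lambda>z. gain \<theta> \<eta> r y (R z)) has_field_derivative 0) (at y)"
    using has_field_derivative_zero_compose_lipschitz[of "gain \<theta> \<eta> r y" R y] lip by simp
  have "isCont R y"
    using isCont_if_nonexpansive[of R y] lip by simp
  \<comment> \<open>\<open>R\<close> is its own Caratheodory factor here, so continuity of
    \<open>R\<close> at \<open>y\<close> suffices.\<close>
  then have 2: "((\<lambda>z. r * \<eta> * ((z - y) * R z)) has_field_derivative r * \<eta> * R y) (at y)"
    by (intro DERIV_cmult) (auto simp: CARAT_DERIV intro!: exI[of _ R])
  have "(\<lambda>z. gain \<theta> \<eta> r z (R z)) = (\<lambda>z. gain \<theta> \<eta> r y (R z) + r * \<eta> * ((z - y) * R z))"
    by (simp add: gain_def algebra_simps fun_eq_iff)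
  moreover have "0 + r * \<eta> * R y = r * (1 + \<theta> + \<eta> * y - exp (r * R y))"
    using arg_cong[OF c, of "\<lambda>u. r * u"] by (simp add: algebra_simps)
  ultimately show ?thesis
    using DERIV_add[OF 1 2] unfolding R_def[symmetric] by metis
qed

section \<open>The tail formula for expectations\<close>

text \<open>Tonelli for \<open>g t\<close> on \<open>0 \<le> t < y\<close>: integrating over
  \<open>t\<close> first gives \<open>G y\<close>, over \<open>y\<close> first gives
  \<open>g t\<close> times the mass above \<open>t\<close>. Working with nonnegative integrals makes
  integrability of the tail integrand a conclusion.\<close>

lemma (in real_distribution) integral_eq_integral_survival:
  fixes G g :: "real \<Rightarrow> real"
  assumes pos: "AE y in M. 0 < y"
    and g[measurable]: "g \<in> borel_measurable borel" and g0: "\<And>t. t \<ge> 0 \<Longrightarrow> g t \<ge> 0"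
    and G: "\<And>t. t \<ge> 0 \<Longrightarrow> (G has_real_derivative g t) (at t)" "G 0 = 0"
    and int: "integrable M G"
  shows "set_integrable lborel {0..} (\<lambda>t. g t * (1 - cdf M t))"
    and "(LBINT t:{0..}. g t * (1 - cdf M t)) = (\<integral>y. G y \<partial>M)"
proof -
  have [measurable]: "cdf M \<in> borel_measurable borel"
    by (intro borel_measurable_mono monoI cdf_nondecreasing)
  have cdf1: "1 - cdf M t \<ge> 0" for t using cdf_bounded_prob[of t] by simp
  have nonneg: "indicator {0..} t * (g t * (1 - cdf M t)) \<ge> 0" for t :: real
    using g0[of t] cdf1[of t] by (auto simp: indicator_def)
  have FTC: "(\<integral>\<^sup>+ t. (if t < y then ennreal (indicator {0..} t * g t) else 0) \<partial>lborel) = ennreal (G y)"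
    if "y > 0" for y
  proof -
    have "(\<integral>\<^sup>+ t. (if t < y then ennreal (indicator {0..} t * g t) else 0) \<partial>lborel)
      = (\<integral>\<^sup>+ t. ennreal (g t) * indicator {0..y} t \<partial>lborel)"
    \<comment> \<open>The strict \<open>t < y\<close> matches \<open>1 - cdf M t\<close>, the mass
      of \<open>{t<..}\<close>; the fundamental theorem of calculus uses \<open>{0..y}\<close>,
      which differs by the null point \<open>y\<close>.\<close>
    proof (rule nn_integral_cong_AE)
      show "AE t in lborel. (if t < y then ennreal (indicator {0..} t * g t) else 0)
          = ennreal (g t) * indicator {0..y} t"
        using AE_lborel_singleton[of y] by eventually_elim (auto simp: indicator_def)
    qed
    also have "\<dots> = ennreal (G y - G 0)"
      using that g0 G by (intro nn_integral_FTC_Icc) auto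
    finally show ?thesis using G by simp
  qed
  have Gpos: "AE y in M. 0 \<le> G y"
    using pos
  proof eventually_elim
    case (elim y)
    have "G 0 \<le> G y"
      using elim g0 G(1) by (intro DERIV_nonneg_imp_nondecreasing[of 0 y G]) force+
    then show ?case using G by simp
  qed
  interpret P: pair_sigma_finite lborel M ..
  have "(\<integral>\<^sup>+ t. ennreal (indicator {0..} t * (g t * (1 - cdf M t))) \<partial>lborel)
    = (\<integral>\<^sup>+ t. (\<integral>\<^sup>+ y. (if t < y then ennreal (indicator {0..} t * g t) else 0) \<partial>M) \<partial>lborel)"
  proof (rule nn_integral_cong)
    fix t :: real
    have "prob {t<..} = 1 - cdf M t"
      using prob_compl[of "{..t}"] by (simp add: cdf_def Compl_eq_Diff_UNIV[symmetric] Compl_atMost)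
    then have "emeasure M {t<..} = ennreal (1 - cdf M t)"
      by (simp add: emeasure_eq_measure)
    moreover have "(\<integral>\<^sup>+ y. (if t < y then ennreal (indicator {0..} t * g t) else 0) \<partial>M)
      = (\<integral>\<^sup>+ y. ennreal (indicator {0..} t * g t) * indicator {t<..} y \<partial>M)"
      by (intro nn_integral_cong) (auto simp: indicator_def)
    moreover have "\<dots> = ennreal (indicator {0..} t * g t) * emeasure M {t<..}"
      by (intro nn_integral_cmult_indicator) simp
    ultimately show "ennreal (indicator {0..} t * (g t * (1 - cdf M t)))
      = (\<integral>\<^sup>+ y. (if t < y then ennreal (indicator {0..} t * g t) else 0) \<partial>M)"
      using cdf1[of t] by (simp add: ennreal_mult'' flip: mult.assoc)
  qed
  also have "\<dots> = (\<integral>\<^sup>+ y. (\<integral>\<^sup>+ t. (if t < y then ennreal (indicator {0..} t * g t) else 0) \<partial>lborel) \<partial>M)"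
    by (rule P.Fubini'[symmetric]) measurable
  also have "\<dots> = (\<integral>\<^sup>+ y. ennreal (G y) \<partial>M)"
    using pos by (intro nn_integral_cong_AE) (auto simp: FTC)
  also have "\<dots> = ennreal (\<integral>y. G y \<partial>M)"
    using int Gpos by (rule nn_integral_eq_integral)
  finally have *: "(\<integral>\<^sup>+ t. ennreal (indicator {0..} t * (g t * (1 - cdf M t))) \<partial>lborel)
    = ennreal (\<integral>y. G y \<partial>M)" .
  show "set_integrable lborel {0..} (\<lambda>t. g t * (1 - cdf M t))"
    unfolding set_integrable_def real_scaleR_def
    by (rule integrableI_nonneg) (use * nonneg in auto)
  show "(LBINT t:{0..}. g t * (1 - cdf M t)) = (\<integral>y. G y \<partial>M)"
    unfolding set_lebesgue_integral_def real_scaleR_def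
    by (rule integral_eq_nn_integral[THEN trans]) 
      (use * nonneg Gpos in \<open>auto simp: integral_nonneg_AE\<close>)
qed

section \<open>Moments and integrability of the claim and its retained part\<close>

locale claim = prob_space M for M :: "'a measure" +
  fixes Y :: "'a \<Rightarrow> real"
  assumes Y_measurable[measurable]: "Y \<in> borel_measurable M"
    and Y_pos: "AE \<omega> in M. 0 < Y \<omega>"
    and Y_mgf: "\<exists>\<epsilon>>0. \<forall>t. \<bar>t\<bar> < \<epsilon> \<longrightarrow> integrable M (\<lambda>\<omega>. exp (t * Y \<omega>))"
begin

text \<open>For some \<open>t > 0\<close> in the domain of the moment generating function,
  \<open>Y ^ n\<close> is dominated through
  \<open>(t * Y / n) ^ n \<le> (1 + t * Y / n) ^ n \<le> exp (t * Y)\<close>.\<close>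

lemma integrable_moment: "integrable M (\<lambda>\<omega>. Y \<omega> ^ n)"
proof (cases "n = 0")
  case False
  obtain \<epsilon> where e: "\<epsilon> > 0" "\<And>t. \<bar>t\<bar> < \<epsilon> \<Longrightarrow> integrable M (\<lambda>\<omega>. exp (t * Y \<omega>))"
    using Y_mgf by blast
  define t where "t = \<epsilon> / 2"
  have t: "t > 0" "integrable M (\<lambda>\<omega>. exp (t * Y \<omega>))" using e(1) e(2)[of "\<epsilon> / 2"] by (auto simp: t_def)
  show ?thesis
  proof (rule Bochner_Integration.integrable_bound)
    show "integrable M (\<lambda>\<omega>. (n / t) ^ n * exp (t * Y \<omega>))" using t by simp
    show "AE \<omega> in M. norm (Y \<omega> ^ n) \<le> norm ((n / t) ^ n * exp (t * Y \<omega>))"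
      using Y_pos
    proof eventually_elim
      case (elim \<omega>)
      have "(t * Y \<omega> / n) ^ n \<le> (1 + t * Y \<omega> / n) ^ n"
        using elim t by (intro power_mono) auto
      also have "\<dots> \<le> exp (t * Y \<omega>)"
        using elim t False by (intro exp_ge_one_plus_x_over_n_power_n) (auto intro: order_trans[of _ 0])
      finally have "(n / t) ^ n * (t * Y \<omega> / n) ^ n \<le> (n / t) ^ n * exp (t * Y \<omega>)"
        using t by (intro mult_left_mono) auto
      moreover have "(n / t) ^ n * (t * Y \<omega> / n) ^ n = Y \<omega> ^ n"
        using t False by (simp flip: power_mult_distrib)
      ultimately show ?case using elim t by simp
    qed
  qed measurable
qed simp

lemmas integrable_moments = integrable_moment[of 1, simplified] integrable_moment[of 2] integrable_moment[of 3]

lemma integral_eq_integral_survival: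
  fixes G g :: "real \<Rightarrow> real"
  assumes "g \<in> borel_measurable borel" "\<And>t. t \<ge> 0 \<Longrightarrow> g t \<ge> 0"
    and "\<And>t. t \<ge> 0 \<Longrightarrow> (G has_real_derivative g t) (at t)" "G 0 = 0"
    and G[measurable]: "G \<in> borel_measurable borel" and "integrable M (\<lambda>\<omega>. G (Y \<omega>))"
  shows "set_integrable lborel {0..} (\<lambda>t. g t * survival M Y t)"
    and "(LBINT t:{0..}. g t * survival M Y t) = (\<integral>\<omega>. G (Y \<omega>) \<partial>M)"
proof -
  interpret N: real_distribution "distr M borel Y" by (rule real_distribution_distr) simp
  have "AE y in distr M borel Y. 0 < y"
    using Y_pos by (simp add: AE_distr_iff)
  note * = N.integral_eq_integral_survival[OF this assms(1-4)]
  show "set_integrable lborel {0..} (\<lambda>t. g t * survival M Y t)"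
    "(LBINT t:{0..}. g t * survival M Y t) = (\<integral>\<omega>. G (Y \<omega>) \<partial>M)"
    unfolding survival_def using assms * by (simp_all add: integrable_distr_eq integral_distr)
qed

text \<open>The tail formula for \<open>t\<close>, \<open>t\<^sup>2 / 2\<close> and
  \<open>t ^ 3 / 3\<close>. The last makes the Lipschitz constant of \<open>excess\<close> an
  integral of an integrable function.\<close>

lemma survival_moments:
  shows "set_integrable lborel {0..} (survival M Y)"
    and "(LBINT t:{0..}. survival M Y t) = (\<integral>\<omega>. Y \<omega> \<partial>M)"
    and "set_integrable lborel {0..} (\<lambda>t. t * survival M Y t)"
    and "(LBINT t:{0..}. t * survival M Y t) = (\<integral>\<omega>. (Y \<omega>)\<^sup>2 \<partial>M) / 2"
    and "set_integrable lborel {0..} (\<lambda>t. t\<^sup>2 * survival M Y t)"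
proof -
  have d1: "((\<lambda>t. t) has_real_derivative 1) (at t)" for t :: real by (rule DERIV_ident)
  have d2: "((\<lambda>t. t\<^sup>2 / 2) has_real_derivative t) (at t)" for t :: real
    by (auto intro!: derivative_eq_intros)
  have d3: "((\<lambda>t. t ^ 3 / 3) has_real_derivative t\<^sup>2) (at t)" for t :: real
    by (auto intro!: derivative_eq_intros)
  have i2: "integrable M (\<lambda>\<omega>. (Y \<omega>)\<^sup>2 / 2)" and i3: "integrable M (\<lambda>\<omega>. Y \<omega> ^ 3 / 3)"
    using integrable_moments by simp_all
  have "set_integrable lborel {0..} (\<lambda>t. 1 * survival M Y t)"
    "(LBINT t:{0..}. 1 * survival M Y t) = (\<integral>\<omega>. Y \<omega> \<partial>M)"
    by (rule integral_eq_integral_survival[of "\<lambda>_. 1" "\<lambda>t. t", OF _ _ d1 _ _ integrable_moments(1)];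
      simp)+
  then show "set_integrable lborel {0..} (survival M Y)"
    "(LBINT t:{0..}. survival M Y t) = (\<integral>\<omega>. Y \<omega> \<partial>M)"
    unfolding mult_1 .
  show "set_integrable lborel {0..} (\<lambda>t. t * survival M Y t)"
    by (rule integral_eq_integral_survival[of "\<lambda>t. t" "\<lambda>t. t\<^sup>2 / 2", OF _ _ d2 _ _ i2]; simp)
  have "(LBINT t:{0..}. t * survival M Y t) = (\<integral>\<omega>. (Y \<omega>)\<^sup>2 / 2 \<partial>M)"
    by (rule integral_eq_integral_survival[of "\<lambda>t. t" "\<lambda>t. t\<^sup>2 / 2", OF _ _ d2 _ _ i2]; simp)
  then show "(LBINT t:{0..}. t * survival M Y t) = (\<integral>\<omega>. (Y \<omega>)\<^sup>2 \<partial>M) / 2"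
    unfolding integral_divide_zero .
  show "set_integrable lborel {0..} (\<lambda>t. t\<^sup>2 * survival M Y t)"
    by (rule integral_eq_integral_survival[of "\<lambda>t. t\<^sup>2" "\<lambda>t. t ^ 3 / 3", OF _ _ d3 _ _ i3]; simp)
qed

lemma integrable_retained:
  assumes "retention R"
  shows "integrable M (\<lambda>\<omega>. R (Y \<omega>))" "integrable M (\<lambda>\<omega>. Y \<omega> * R (Y \<omega>))"
    "integrable M (\<lambda>\<omega>. (R (Y \<omega>))\<^sup>2)"
proof -
  have [measurable]: "R \<in> borel_measurable borel" using assms by (simp add: retention_def)
  have R: "AE \<omega> in M. 0 < Y \<omega> \<and> 0 \<le> R (Y \<omega>) \<and> R (Y \<omega>) \<le> Y \<omega>"
    using Y_pos by eventually_elim (use assms in \<open>simp add: retention_def\<close>)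
  show "integrable M (\<lambda>\<omega>. R (Y \<omega>))"
  proof (rule Bochner_Integration.integrable_bound[OF integrable_moments(1)])
    show "AE \<omega> in M. norm (R (Y \<omega>)) \<le> norm (Y \<omega>)"
      using R by eventually_elim simp
  qed measurable
  show "integrable M (\<lambda>\<omega>. Y \<omega> * R (Y \<omega>))"
  proof (rule Bochner_Integration.integrable_bound[OF integrable_moments(2)])
    show "AE \<omega> in M. norm (Y \<omega> * R (Y \<omega>)) \<le> norm ((Y \<omega>)\<^sup>2)"
      using R by eventually_elim (simp add: power2_eq_square mult_left_mono)
  qed measurable
  show "integrable M (\<lambda>\<omega>. (R (Y \<omega>))\<^sup>2)"
  proof (rule Bochner_Integration.integrable_bound[OF integrable_moments(2)])
    show "AE \<omega> in M. norm ((R (Y \<omega>))\<^sup>2) \<le> norm ((Y \<omega>)\<^sup>2)"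
      using R by eventually_elim (simp add: power_mono)
  qed measurable
qed

lemma integrable_gain:
  assumes "retention R" "integrable M (\<lambda>\<omega>. exp (r * R (Y \<omega>)))"
  shows "integrable M (\<lambda>\<omega>. gain \<theta> \<eta> r (Y \<omega>) (R (Y \<omega>)))"
  unfolding gain_def
  by (intro Bochner_Integration.integrable_diff Bochner_Integration.integrable_add
      integrable_mult_right integrable_const integrable_retained[OF assms(1)] assms(2))

lemma adj_fun_eq_gain:
  assumes "retention R" "integrable M (\<lambda>\<omega>. exp (r * R (Y \<omega>)))"
  shows "adj_fun M Y lam \<beta> c \<theta> \<eta> R r = - kappa M Y lam c \<theta> \<eta> * r
    + lam * (\<integral>\<omega>. gain \<theta> \<eta> r (Y \<omega>) (R (Y \<omega>)) \<partial>M) - 1 / 2 * \<beta>\<^sup>2 * r\<^sup>2"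
proof -
  note i = integrable_retained[OF assms(1)] assms(2)
  define a where "a = (1 + \<theta>) * (\<integral>\<omega>. R (Y \<omega>) \<partial>M) + \<eta> * (\<integral>\<omega>. Y \<omega> * R (Y \<omega>) \<partial>M)
      - \<eta> / 2 * (\<integral>\<omega>. (R (Y \<omega>))\<^sup>2 \<partial>M)"
  define m where "m = (\<integral>\<omega>. exp (r * R (Y \<omega>)) \<partial>M) - 1"
  have gain: "(\<integral>\<omega>. gain \<theta> \<eta> r (Y \<omega>) (R (Y \<omega>)) \<partial>M) = r * a - m"
    unfolding gain_def a_def m_def using i by (simp add: prob_space)
  show ?thesis
    unfolding adj_fun_def gain a_def[symmetric] m_def[symmetric] by (simp add: algebra_simps)
qed

text \<open>The moment generating function of \<open>Y\<close> may be infinite at \<open>r\<close>,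
  but under the optimal retention the exponential grows at most linearly in the claim.\<close>

lemma integrable_exp_Rtilde:
  assumes "r > 0" "\<theta> \<ge> 0" "\<eta> \<ge> 0"
  shows "integrable M (\<lambda>\<omega>. exp (r * Rtilde \<theta> \<eta> r (Y \<omega>)))"
proof (rule Bochner_Integration.integrable_bound)
  have [measurable]: "Rtilde \<theta> \<eta> r \<in> borel_measurable borel"
    using Rtilde_retention[OF assms] by (simp add: retention_def)
  show "(\<lambda>\<omega>. exp (r * Rtilde \<theta> \<eta> r (Y \<omega>))) \<in> borel_measurable M" by measurable
  show "integrable M (\<lambda>\<omega>. 1 + \<theta> + \<eta> * Y \<omega>)" using integrable_moments by simp
  show "AE \<omega> in M. norm (exp (r * Rtilde \<theta> \<eta> r (Y \<omega>))) \<le> norm (1 + \<theta> + \<eta> * Y \<omega>)"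
    using Y_pos
  proof eventually_elim
    case (elim \<omega>)
    then show ?case using exp_Rtilde_le[OF assms, of "Y \<omega>"] by simp
  qed
qed

section \<open>The maximal slope\<close>

text \<open>For \<open>r > 0\<close> this is \<open>r\<close> times the integral of
  \<open>opt_integrand\<close>. Without the division by \<open>r\<close> it extends to
  \<open>r = 0\<close> with value \<open>0\<close>.\<close>

definition excess :: "real \<Rightarrow> real \<Rightarrow> real \<Rightarrow> real" where
  "excess \<theta> \<eta> r = (LBINT t:{0..}. (exp (r * Rtilde \<theta> \<eta> r t) - 1) * survival M Y t)"

text \<open>The tail formula applies with the maximal gain as \<open>G\<close> and its envelope
  derivative, nonnegative by \<open>exp_Rtilde_le\<close>, as \<open>g\<close>. That derivative is
  affine in \<open>exp (r * Rtilde \<theta> \<eta> r t)\<close>, so the relation can be solved for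
  \<open>excess\<close>.\<close>

lemma integral_gain_Rtilde:
  assumes r: "r > 0" "\<theta> \<ge> 0" "\<eta> \<ge> 0"
  shows "set_integrable lborel {0..} (\<lambda>t. (exp (r * Rtilde \<theta> \<eta> r t) - 1) * survival M Y t)"
    and "(\<integral>\<omega>. gain \<theta> \<eta> r (Y \<omega>) (Rtilde \<theta> \<eta> r (Y \<omega>)) \<partial>M)
      = r * (\<theta> * (\<integral>\<omega>. Y \<omega> \<partial>M) + \<eta> / 2 * (\<integral>\<omega>. (Y \<omega>)\<^sup>2 \<partial>M) - excess \<theta> \<eta> r)"
proof -
  let ?S = "survival M Y"
  let ?R = "Rtilde \<theta> \<eta> r"
  let ?g = "\<lambda>t. r * (1 + \<theta> + \<eta> * t - exp (r * ?R t))"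
  let ?G = "\<lambda>y. gain \<theta> \<eta> r y (?R y)"
  have [measurable]: "?R \<in> borel_measurable borel"
    using Rtilde_retention[OF r] by (simp add: retention_def)
  have "?R 0 = 0" using Rtilde_char(1,4)[OF r, of 0] by simp
  then have G0: "?G 0 = 0" by (simp add: gain_def)
  have g0: "?g t \<ge> 0" if "t \<ge> 0" for t
    using exp_Rtilde_le[OF r that] r by simp
  have g_meas: "?g \<in> borel_measurable borel" by measurable
  have G_meas: "?G \<in> borel_measurable borel" unfolding gain_def by measurable
  have tail: "set_integrable lborel {0..} (\<lambda>t. ?g t * ?S t)"
    "(LBINT t:{0..}. ?g t * ?S t) = (\<integral>\<omega>. ?G (Y \<omega>) \<partial>M)"
    by (rule integral_eq_integral_survival[of ?g ?G, OF g_meas _ DERIV_gain_Rtilde[OF r] G0 G_meas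
      integrable_gain[OF Rtilde_retention[OF r] integrable_exp_Rtilde[OF r]]]; rule g0; assumption)+
  have eq: "(\<lambda>t. (exp (r * ?R t) - 1) * ?S t)
    = (\<lambda>t. \<theta> * ?S t + \<eta> * (t * ?S t) - 1 / r * (?g t * ?S t))"
    using r by (simp add: fun_eq_iff field_simps)
  have 1: "set_integrable lborel {0..} (\<lambda>t. \<theta> * ?S t + \<eta> * (t * ?S t))"
    by (intro set_integral_add set_integrable_mult_right survival_moments)
  have 2: "set_integrable lborel {0..} (\<lambda>t. 1 / r * (?g t * ?S t))"
    by (intro set_integrable_mult_right tail(1))
  show "set_integrable lborel {0..} (\<lambda>t. (exp (r * ?R t) - 1) * ?S t)"
    unfolding eq by (intro set_integral_diff 1 2)
  have "excess \<theta> \<eta> r = (LBINT t:{0..}. \<theta> * ?S t + \<eta> * (t * ?S t)) - (LBINT t:{0..}. 1 / r * (?g t * ?S t))"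
    unfolding excess_def eq by (intro set_integral_diff 1 2)
  also have "(LBINT t:{0..}. \<theta> * ?S t + \<eta> * (t * ?S t))
    = (LBINT t:{0..}. \<theta> * ?S t) + (LBINT t:{0..}. \<eta> * (t * ?S t))"
    by (intro set_integral_add set_integrable_mult_right survival_moments)
  finally have "excess \<theta> \<eta> r = \<theta> * (\<integral>\<omega>. Y \<omega> \<partial>M) + \<eta> * ((\<integral>\<omega>. (Y \<omega>)\<^sup>2 \<partial>M) / 2)
    - 1 / r * (\<integral>\<omega>. ?G (Y \<omega>) \<partial>M)"
    unfolding set_integral_mult_right survival_moments(2,4) tail(2) .
  then show "(\<integral>\<omega>. ?G (Y \<omega>) \<partial>M)
      = r * (\<theta> * (\<integral>\<omega>. Y \<omega> \<partial>M) + \<eta> / 2 * (\<integral>\<omega>. (Y \<omega>)\<^sup>2 \<partial>M) - excess \<theta> \<eta> r)"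
    using r by (simp add: field_simps)
qed

lemma survival_nonneg: "survival M Y t \<ge> 0"
proof -
  interpret N: real_distribution "distr M borel Y" by (rule real_distribution_distr) simp
  show ?thesis using N.cdf_bounded_prob[of t] by (simp add: survival_def)
qed

lemma excess_0: "excess \<theta> \<eta> 0 = 0"
  by (simp add: excess_def)

lemma excess_increment:
  assumes r: "0 \<le> r" "r \<le> r'" "\<theta> \<ge> 0" "\<eta> \<ge> 0"
  shows "excess \<theta> \<eta> r \<le> excess \<theta> \<eta> r'"
    and "excess \<theta> \<eta> r' - excess \<theta> \<eta> r
      \<le> (r' - r) * (LBINT t:{0..}. t * (1 + \<theta> + \<eta> * t) * survival M Y t)"
proof -
  let ?S = "survival M Y"
  let ?e = "\<lambda>r t. (exp (r * Rtilde \<theta> \<eta> r t) - 1) * ?S t"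
  \<comment> \<open>At \<open>s = 0\<close> the integrand is identically \<open>0\<close>;
    \<open>integral_gain_Rtilde\<close> covers positive \<open>s\<close>.\<close>
  have int: "set_integrable lborel {0..} (?e s)" if "s \<ge> 0" for s
    using integral_gain_Rtilde(1)[of s \<theta> \<eta>] r that by (cases "s = 0") (auto simp: set_integrable_def)
  note ints = int[OF r(1)] int[OF order_trans[OF r(1,2)]]
  show "excess \<theta> \<eta> r \<le> excess \<theta> \<eta> r'"
    unfolding excess_def
    using exp_Rtilde_diff_le(1)[OF r] survival_nonneg
    by (intro set_integral_mono ints mult_right_mono) auto
  have eq: "(\<lambda>t. t * (1 + \<theta> + \<eta> * t) * ?S t) = (\<lambda>t. (1 + \<theta>) * (t * ?S t) + \<eta> * (t\<^sup>2 * ?S t))"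
    by (simp add: fun_eq_iff algebra_simps power2_eq_square)
  have bound_int: "set_integrable lborel {0..} (\<lambda>t. t * (1 + \<theta> + \<eta> * t) * ?S t)"
    unfolding eq by (intro set_integral_add set_integrable_mult_right survival_moments)
  have "excess \<theta> \<eta> r' - excess \<theta> \<eta> r = (LBINT t:{0..}. ?e r' t - ?e r t)"
    unfolding excess_def by (intro set_integral_diff(2)[symmetric] ints)
  also have "\<dots> \<le> (LBINT t:{0..}. (r' - r) * (t * (1 + \<theta> + \<eta> * t) * ?S t))"
  proof (intro set_integral_mono set_integral_diff(1) set_integrable_mult_right ints bound_int)
    fix t :: real assume "t \<in> {0..}"
    then have "(exp (r' * Rtilde \<theta> \<eta> r' t) - exp (r * Rtilde \<theta> \<eta> r t)) * ?S t
      \<le> (r' - r) * (t * (1 + \<theta> + \<eta> * t)) * ?S t"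
      using exp_Rtilde_diff_le(2)[OF r] by (intro mult_right_mono survival_nonneg) auto
    then show "?e r' t - ?e r t \<le> (r' - r) * (t * (1 + \<theta> + \<eta> * t) * ?S t)"
      by (simp add: algebra_simps)
  qed
  also have "\<dots> = (r' - r) * (LBINT t:{0..}. t * (1 + \<theta> + \<eta> * t) * ?S t)"
    by (rule set_integral_mult_right)
  finally show "excess \<theta> \<eta> r' - excess \<theta> \<eta> r
      \<le> (r' - r) * (LBINT t:{0..}. t * (1 + \<theta> + \<eta> * t) * ?S t)" .
qed

lemma continuous_on_excess:
  assumes "\<theta> \<ge> 0" "\<eta> \<ge> 0"
  shows "continuous_on {0..} (excess \<theta> \<eta>)"
proof -
  \<comment> \<open>The absolute value directly supplies the nonnegativity required of a Lipschitz
    constant.\<close>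
  define K where "K = \<bar>LBINT t:{0..}. t * (1 + \<theta> + \<eta> * t) * survival M Y t\<bar>"
  have K: "\<bar>excess \<theta> \<eta> b - excess \<theta> \<eta> a\<bar> \<le> K * (b - a)" if "0 \<le> a" "a \<le> b" for a b
  proof -
    have "(b - a) * (LBINT t:{0..}. t * (1 + \<theta> + \<eta> * t) * survival M Y t) \<le> (b - a) * K"
      using that by (intro mult_left_mono) (auto simp: K_def)
    then show ?thesis
      using excess_increment[OF that assms] by (simp add: mult.commute)
  qed
  have "K-lipschitz_on {0..} (excess \<theta> \<eta>)"
  proof (rule lipschitz_onI)
    fix a b :: real assume "a \<in> {0..}" "b \<in> {0..}"
    then show "dist (excess \<theta> \<eta> a) (excess \<theta> \<eta> b) \<le> K * dist a b"
      using K[of a b] K[of b a] by (cases "a \<le> b") (auto simp: dist_real_def abs_minus_commute)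
  qed (simp add: K_def)
  then show ?thesis by (rule lipschitz_on_continuous_on)
qed

text \<open>For \<open>r > 0\<close>, \<open>r * slope r\<close> is the maximum over all retention functions of the left-hand
  side of the equation defining the adjustment coefficient.\<close>
definition slope :: "real \<Rightarrow> real \<Rightarrow> real \<Rightarrow> real \<Rightarrow> real \<Rightarrow> real \<Rightarrow> real" where
  "slope lam \<beta> c \<theta> \<eta> r = c - lam * (\<integral>\<omega>. Y \<omega> \<partial>M) - lam * excess \<theta> \<eta> r - \<beta>\<^sup>2 / 2 * r"

text \<open>Strictness comes from the Brownian term, as \<open>\<beta> > 0\<close>;
  \<open>excess\<close> contributes weak monotonicity.\<close>

lemma slope_strict_antimono:
  assumes "0 \<le> r" "r < r'" "lam > 0" "\<beta> > 0" "\<theta> \<ge> 0" "\<eta> \<ge> 0"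
  shows "slope lam \<beta> c \<theta> \<eta> r' < slope lam \<beta> c \<theta> \<eta> r"
proof -
  have "lam * excess \<theta> \<eta> r \<le> lam * excess \<theta> \<eta> r'"
    using excess_increment(1)[of r r' \<theta> \<eta>] assms by simp
  moreover have "\<beta>\<^sup>2 / 2 * r < \<beta>\<^sup>2 / 2 * r'" using assms by simp
  ultimately show ?thesis unfolding slope_def by linarith
qed

lemma slope_has_root:
  assumes "lam > 0" "\<beta> > 0" "\<theta> \<ge> 0" "\<eta> \<ge> 0" and c: "c > lam * (\<integral>\<omega>. Y \<omega> \<partial>M)"
  obtains r where "r > 0" "slope lam \<beta> c \<theta> \<eta> r = 0"
proof -
  define d where "d = c - lam * (\<integral>\<omega>. Y \<omega> \<partial>M)"
  \<comment> \<open>At \<open>b\<close> the Brownian term alone uses up \<open>d\<close>, so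
    \<open>slope\<close> is nonpositive there, while it equals \<open>d > 0\<close> at
    \<open>0\<close>.\<close>
  define b where "b = 2 * d / \<beta>\<^sup>2"
  have b: "b > 0" using assms by (simp add: b_def d_def)
  have "excess \<theta> \<eta> b \<ge> 0" using excess_increment(1)[of 0 b \<theta> \<eta>] b assms by (simp add: excess_0)
  moreover have "\<beta>\<^sup>2 / 2 * b = d" using assms by (simp add: b_def)
  ultimately have "slope lam \<beta> c \<theta> \<eta> b \<le> 0"
    using assms by (simp add: slope_def d_def)
  moreover have pos: "0 < slope lam \<beta> c \<theta> \<eta> 0" using c by (simp add: slope_def excess_0)
  moreover have "continuous_on {0..b} (slope lam \<beta> c \<theta> \<eta>)"
    unfolding slope_def
    by (intro continuous_intros continuous_on_subset[OF continuous_on_excess]) (use assms in auto)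
  ultimately obtain r where "0 \<le> r" "slope lam \<beta> c \<theta> \<eta> r = 0"
    using IVT2'[of "slope lam \<beta> c \<theta> \<eta>" b 0 0] b by auto
  with pos have "r > 0" "slope lam \<beta> c \<theta> \<eta> r = 0" by (auto simp: less_le)
  then show thesis by (rule that)
qed

section \<open>The slope in terms of \<open>opt_eq\<close> and \<open>adj_fun\<close>\<close>

lemma opt_integrand_eq:
  "opt_integrand M Y \<theta> \<eta> r = (\<lambda>t. 1 / r * ((exp (r * Rtilde \<theta> \<eta> r t) - 1) * survival M Y t))"
  by (simp add: opt_integrand_def fun_eq_iff)

lemma opt_eq_iff_slope:
  assumes "r > 0"
  shows "opt_eq M Y lam \<beta> c \<theta> \<eta> r \<longleftrightarrow> slope lam \<beta> c \<theta> \<eta> r = 0"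
proof -
  have "(LBINT t:{0..}. opt_integrand M Y \<theta> \<eta> r t) = 1 / r * excess \<theta> \<eta> r"
    unfolding excess_def opt_integrand_eq by (simp only: set_integral_mult_right)
  then show ?thesis using assms by (auto simp: opt_eq_def slope_def field_simps)
qed

lemma set_integrable_opt_integrand:
  assumes "r > 0" "\<theta> \<ge> 0" "\<eta> \<ge> 0"
  shows "set_integrable lborel {0..} (opt_integrand M Y \<theta> \<eta> r)"
  unfolding opt_integrand_eq by (intro set_integrable_mult_right integral_gain_Rtilde(1) assms)

text \<open>The \<open>\<theta>\<close> and \<open>\<eta>\<close> terms of the maximal expected gain
  cancel against those of \<open>kappa\<close>, leaving \<open>c - lam * E Y\<close>.\<close>

lemma adj_fun_Rtilde:
  assumes r: "r > 0" "\<theta> \<ge> 0" "\<eta> \<ge> 0"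
  shows "adj_fun M Y lam \<beta> c \<theta> \<eta> (Rtilde \<theta> \<eta> r) r = r * slope lam \<beta> c \<theta> \<eta> r"
  unfolding adj_fun_eq_gain[OF Rtilde_retention[OF r] integrable_exp_Rtilde[OF r]]
    integral_gain_Rtilde(2)[OF r] kappa_def slope_def
  by (simp add: algebra_simps power2_eq_square)

lemma adj_fun_le_slope:
  assumes r: "r > 0" "\<theta> \<ge> 0" "\<eta> \<ge> 0" and "lam > 0"
    and R: "retention R" "integrable M (\<lambda>\<omega>. exp (r * R (Y \<omega>)))"
  shows "adj_fun M Y lam \<beta> c \<theta> \<eta> R r \<le> r * slope lam \<beta> c \<theta> \<eta> r"
proof -
  note opt = Rtilde_retention[OF r] integrable_exp_Rtilde[OF r]
  have "(\<integral>\<omega>. gain \<theta> \<eta> r (Y \<omega>) (R (Y \<omega>)) \<partial>M)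
    \<le> (\<integral>\<omega>. gain \<theta> \<eta> r (Y \<omega>) (Rtilde \<theta> \<eta> r (Y \<omega>)) \<partial>M)"
  proof (rule integral_mono_AE[OF integrable_gain[OF R] integrable_gain[OF opt]])
    show "AE \<omega> in M. gain \<theta> \<eta> r (Y \<omega>) (R (Y \<omega>)) \<le> gain \<theta> \<eta> r (Y \<omega>) (Rtilde \<theta> \<eta> r (Y \<omega>))"
      using Y_pos
    proof eventually_elim
      case (elim \<omega>)
      then show ?case using R by (intro gain_le_gain_Rtilde r) (simp add: retention_def)
    qed
  qed
  then have "lam * (\<integral>\<omega>. gain \<theta> \<eta> r (Y \<omega>) (R (Y \<omega>)) \<partial>M)
    \<le> lam * (\<integral>\<omega>. gain \<theta> \<eta> r (Y \<omega>) (Rtilde \<theta> \<eta> r (Y \<omega>)) \<partial>M)"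
    using \<open>lam > 0\<close> by simp
  then show ?thesis
    unfolding adj_fun_Rtilde[OF r, symmetric] adj_fun_eq_gain[OF R] adj_fun_eq_gain[OF opt] by simp
qed

section \<open>Adjustment coefficients\<close>

text \<open>After division by \<open>r\<close>, the jump term \<open>(exp (r * x) - 1) / r\<close>
  is nondecreasing in \<open>r\<close> for every \<open>x\<close>, and the Brownian term is strictly
  increasing. Both are subtracted from a constant, so there is at most one positive root. The proof
  keeps the inequalities cross-multiplied.\<close>

lemma is_adj_coeff_unique:
  assumes "lam > 0" "\<beta> > 0"
    and "is_adj_coeff M Y lam \<beta> c \<theta> \<eta> R r" "is_adj_coeff M Y lam \<beta> c \<theta> \<eta> R s"
  shows "r = s"
proof -
  have False if rs: "r < s" and r: "is_adj_coeff M Y lam \<beta> c \<theta> \<eta> R r"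
    and s: "is_adj_coeff M Y lam \<beta> c \<theta> \<eta> R s" for r s
  proof -
    define A where "A = - kappa M Y lam c \<theta> \<eta>
        + lam * ((1 + \<theta>) * (\<integral>\<omega>. R (Y \<omega>) \<partial>M)
                 + \<eta> * (\<integral>\<omega>. Y \<omega> * R (Y \<omega>) \<partial>M)
                 - \<eta> / 2 * (\<integral>\<omega>. (R (Y \<omega>))\<^sup>2 \<partial>M))"
    define m where "m t = (\<integral>\<omega>. exp (t * R (Y \<omega>)) \<partial>M) - 1" for t
    have r0: "r > 0" and ir: "integrable M (\<lambda>\<omega>. exp (r * R (Y \<omega>)))"
      and er: "A * r - 1 / 2 * \<beta>\<^sup>2 * r\<^sup>2 = lam * m r"
      using r by (simp_all add: is_adj_coeff_def adj_fun_def A_def m_def)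
    have is': "integrable M (\<lambda>\<omega>. exp (s * R (Y \<omega>)))"
      and es: "A * s - 1 / 2 * \<beta>\<^sup>2 * s\<^sup>2 = lam * m s"
      using s by (simp_all add: is_adj_coeff_def adj_fun_def A_def m_def)
    \<comment> \<open>Convexity of \<open>exp\<close>: the tangent at \<open>r * x\<close> is
      compared with \<open>exp\<close> at \<open>s * x\<close> and at \<open>0\<close>, weighted by
      \<open>r\<close> and \<open>s - r\<close>; the linear terms cancel.\<close>
    have "s * (exp (r * x) - 1) \<le> r * (exp (s * x) - 1)" for x
    proof -
      have "exp (r * x) * (1 + (s - r) * x) \<le> exp (r * x) * exp ((s - r) * x)"
        by (intro mult_left_mono exp_ge_add_one_self) auto
      also have "\<dots> = exp (s * x)" by (simp add: algebra_simps flip: exp_add)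
      finally have 1: "r * (exp (r * x) * (1 + (s - r) * x)) \<le> r * exp (s * x)" using r0 by simp
      have "exp (r * x) * (1 + - (r * x)) \<le> exp (r * x) * exp (- (r * x))"
        by (intro mult_left_mono exp_ge_add_one_self) auto
      then have "(s - r) * (exp (r * x) * (1 - r * x)) \<le> (s - r) * 1"
        using rs by (intro mult_left_mono) (auto simp flip: exp_add)
      with 1 show ?thesis by (simp add: algebra_simps)
    qed
    then have "(\<integral>\<omega>. s * (exp (r * R (Y \<omega>)) - 1) \<partial>M) \<le> (\<integral>\<omega>. r * (exp (s * R (Y \<omega>)) - 1) \<partial>M)"
      using ir is' by (intro integral_mono) auto
    then have "s * m r \<le> r * m s"
      using ir is' by (simp add: m_def prob_space)
    then have "lam * (s * m r) \<le> lam * (r * m s)" using assms by simp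
    then have "s * (A * r - 1 / 2 * \<beta>\<^sup>2 * r\<^sup>2) \<le> r * (A * s - 1 / 2 * \<beta>\<^sup>2 * s\<^sup>2)"
      unfolding er es by (simp add: mult_ac)
    then have "(1 / 2 * \<beta>\<^sup>2 * r * s) * (s - r) \<le> 0"
      by (simp add: algebra_simps power2_eq_square)
    moreover have "(1 / 2 * \<beta>\<^sup>2 * r * s) * (s - r) > 0"
      using r0 rs assms by simp
    ultimately show False by simp
  qed
  with assms(3,4) show ?thesis by (metis linorder_neqE)
qed

lemma adj_coeff_eqI:
  assumes "lam > 0" "\<beta> > 0" "is_adj_coeff M Y lam \<beta> c \<theta> \<eta> R r"
  shows "adj_coeff M Y lam \<beta> c \<theta> \<eta> R = r"
  unfolding adj_coeff_def using assms is_adj_coeff_unique[OF assms(1,2)] by (intro the_equality) auto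

end

theorem theorem4p1:
  fixes M :: "'a measure" and Y :: "'a \<Rightarrow> real" and lam \<beta> c \<theta> \<eta> :: real
  assumes "prob_space M"
    and "Y \<in> borel_measurable M"
    and "AE \<omega> in M. 0 < Y \<omega>"
    and "cdf (distr M borel Y) 0 = 0"
    and "\<And>y. y > 0 \<Longrightarrow> 0 < cdf (distr M borel Y) y \<and> cdf (distr M borel Y) y < 1"
    and "\<exists>\<epsilon>>0. \<forall>t. \<bar>t\<bar> < \<epsilon> \<longrightarrow> integrable M (\<lambda>\<omega>. exp (t * Y \<omega>))"
    and "lam > 0" and "\<beta> > 0" and "\<theta> \<ge> 0" and "\<eta> \<ge> 0"
    and "c > lam * (\<integral>\<omega>. Y \<omega> \<partial>M)"
    and "kappa M Y lam c \<theta> \<eta> > 0"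
  shows "(\<forall>r y. r > 0 \<longrightarrow> y \<ge> 1 / r * ln (1 + \<theta>) \<longrightarrow> (\<exists>!R. R \<in> {0..y} \<and> Rc_eq \<theta> \<eta> r y R)) \<and>
    (\<forall>r>0. set_integrable lborel {0..} (opt_integrand M Y \<theta> \<eta> r)) \<and>
    (let A = adj_retentions M Y lam \<beta> c \<theta> \<eta>;
         \<rho> = adj_coeff M Y lam \<beta> c \<theta> \<eta>;
         \<rho>J = (SUP R\<in>A. \<rho> R)
     in bdd_above (\<rho> ` A) \<and>
        \<rho>J > 0 \<and>
        opt_eq M Y lam \<beta> c \<theta> \<eta> \<rho>J \<and>
        (\<forall>r>0. opt_eq M Y lam \<beta> c \<theta> \<eta> r \<longrightarrow> r = \<rho>J) \<and>
        Rtilde \<theta> \<eta> \<rho>J \<in> A \<and>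
        \<rho> (Rtilde \<theta> \<eta> \<rho>J) = \<rho>J)"
proof -
  interpret claim M Y using assms(1-3,6) by (simp add: claim_def claim_axioms_def)
  let ?A = "adj_retentions M Y lam \<beta> c \<theta> \<eta>"
  let ?\<rho> = "adj_coeff M Y lam \<beta> c \<theta> \<eta>"
  let ?\<Phi> = "slope lam \<beta> c \<theta> \<eta>"
  note par = assms(7-10)
  obtain s where s: "s > 0" "?\<Phi> s = 0"
    using slope_has_root[OF par assms(11)] .
  have "is_adj_coeff M Y lam \<beta> c \<theta> \<eta> (Rtilde \<theta> \<eta> s) s"
    using s par integrable_exp_Rtilde[of s \<theta> \<eta>] by (simp add: is_adj_coeff_def adj_fun_Rtilde)
  then have opt: "Rtilde \<theta> \<eta> s \<in> ?A" "?\<rho> (Rtilde \<theta> \<eta> s) = s"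
    using Rtilde_retention[of s \<theta> \<eta>] s par adj_coeff_eqI[of lam \<beta>]
    by (auto simp: adj_retentions_def)
  have le: "?\<rho> R \<le> s" if "R \<in> ?A" for R
  proof -
    obtain r where R: "retention R" and r: "is_adj_coeff M Y lam \<beta> c \<theta> \<eta> R r"
      using \<open>R \<in> ?A\<close> by (auto simp: adj_retentions_def)
    then have r0: "r > 0" and "integrable M (\<lambda>\<omega>. exp (r * R (Y \<omega>)))"
      and "adj_fun M Y lam \<beta> c \<theta> \<eta> R r = 0"
      by (simp_all add: is_adj_coeff_def)
    \<comment> \<open>At its own root, \<open>R\<close> does no better than the optimal retention
      for that same \<open>r\<close>, so \<open>?\<Phi> r\<close> is at least
      \<open>0 = ?\<Phi> s\<close>.\<close>
    then have "0 \<le> r * ?\<Phi> r"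
      using adj_fun_le_slope[OF r0 par(3,4,1) R, of \<beta> c] by simp
    then have "?\<Phi> s \<le> ?\<Phi> r" using r0 s by (simp add: zero_le_mult_iff)
    then have "r \<le> s"
      using slope_strict_antimono[of s r lam \<beta> \<theta> \<eta> c] s par by fastforce
    then show ?thesis using adj_coeff_eqI[OF par(1,2) r] by simp
  qed
  have bdd: "bdd_above (?\<rho> ` ?A)" using le by (auto intro!: bdd_aboveI[of _ s])
  have sup: "(SUP R\<in>?A. ?\<rho> R) = s"
    using opt le by (intro cSup_eq_maximum) (auto intro: rev_image_eqI)
  have "r = s" if "r > 0" "opt_eq M Y lam \<beta> c \<theta> \<eta> r" for r
    using that s slope_strict_antimono[of s r lam \<beta> \<theta> \<eta> c]
      slope_strict_antimono[of r s lam \<beta> \<theta> \<eta> c] par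
    by (cases r s rule: linorder_cases) (auto simp: opt_eq_iff_slope)
  moreover have "opt_eq M Y lam \<beta> c \<theta> \<eta> s" using s by (simp add: opt_eq_iff_slope)
  ultimately show ?thesis
    unfolding Let_def sup
    using Rc_ex1[OF _ par(3,4)] set_integrable_opt_integrand[OF _ par(3,4)] bdd s opt by blast
qed

end
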